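(* There exists an absolute constant $c>0$ such that for every integer $n>1$, if $G$ is the line graph of the complete graph $K_n$, then the conflict-free chromatic number of $G$ satisfies $\chi_{CF}(G)\ge c\ln n$. (That is, $\chi_{CF}(G)=\Omega(\ln n)$.)
   Context: All graphs are finite and simple. For a vertex $v$ of $G$, the closed neighborhood $N[v]$ consists of $v$ and all its neighbors. A (not necessarily proper) coloring of the vertices of $G$ is conflict-free if for every vertex $v\in V(G)$ there is a color that appears on exactly one vertex of $N[v]$. The conflict-free chromatic number $\chi_{CF}(G)$ is the minimum number of colors in a conflict-free coloring of the vertices of $G$ (every vertex is colored). The line graph of a graph $H$ has vertex set $E(H)$, with two distinct edges of $H$ adjacent iff they share an endpoint. *)

theory Defs
  imports Complex_Main
begin

record 'a graph =
  verts :: "'a set"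
  edges :: "'a set set"

definition finite_simple_graph :: "'a graph \<Rightarrow> bool" where
  "finite_simple_graph G \<longleftrightarrow>
     finite (verts G) \<and> (\<forall>e\<in>edges G. e \<subseteq> verts G \<and> card e = 2)"

definition complete_graph :: "nat \<Rightarrow> nat graph" where
  "complete_graph n = \<lparr>verts = {1..n}, edges = {e. e \<subseteq> {1..n} \<and> card e = 2}\<rparr>"

definition line_graph :: "'a graph \<Rightarrow> 'a set graph" where
  "line_graph H =
     \<lparr>verts = edges H,
      edges = {{e, f} | e f. e \<in> edges H \<and> f \<in> edges H \<and> e \<noteq> f \<and> e \<inter> f \<noteq> {}}\<rparr>"

definition closed_nbhd :: "'a graph \<Rightarrow> 'a \<Rightarrow> 'a set" where
  "closed_nbhd G v = insert v {u. {u, v} \<in> edges G}"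

definition conflict_free :: "'a graph \<Rightarrow> ('a \<Rightarrow> 'c) \<Rightarrow> bool" where
  "conflict_free G col \<longleftrightarrow>
     (\<forall>v\<in>verts G. \<exists>c. \<exists>!u. u \<in> closed_nbhd G v \<and> col u = c)"

text \<open>
  Taking colors in \<^typ>\<open>nat\<close> loses nothing for finite graphs.
\<close>

definition cf_chromatic_number :: "'a graph \<Rightarrow> nat" where
  "cf_chromatic_number G =
     (LEAST k. \<exists>col :: 'a \<Rightarrow> nat. conflict_free G col \<and> card (col ` verts G) = k)"

lemma finite_simple_graph_complete_graph: "finite_simple_graph (complete_graph n)"
  by (simp add: finite_simple_graph_def complete_graph_def)

lemma finite_simple_graph_line_graph:
  assumes "finite_simple_graph H"
  shows "finite_simple_graph (line_graph H)"
proof -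
  have "edges H \<subseteq> Pow (verts H)" "finite (verts H)"
    using assms by (auto simp: finite_simple_graph_def)
  then have "finite (edges H)"
    by (meson finite_Pow_iff finite_subset)
  then show ?thesis
    by (fastforce simp: finite_simple_graph_def line_graph_def card_2_iff)
qed

lemma conflict_free_if_inj_on:
  assumes "finite_simple_graph G" and "inj_on col (verts G)"
  shows "conflict_free G col"
  unfolding conflict_free_def
proof
  fix v assume v: "v \<in> verts G"
  have sub: "closed_nbhd G v \<subseteq> verts G"
    using assms(1) v by (auto simp: closed_nbhd_def finite_simple_graph_def)
  have "\<exists>!u. u \<in> closed_nbhd G v \<and> col u = col v"
  proof (rule ex1I[of _ v])
    show "v \<in> closed_nbhd G v \<and> col v = col v"
      by (simp add: closed_nbhd_def)
    show "u = v" if "u \<in> closed_nbhd G v \<and> col u = col v" for u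
      using that sub v inj_onD[OF assms(2)] by blast
  qed
  then show "\<exists>c. \<exists>!u. u \<in> closed_nbhd G v \<and> col u = c" ..
qed

text \<open>The minimum defining the conflict-free chromatic number is attained.\<close>

lemma cf_chromatic_number_attained:
  assumes "finite_simple_graph G"
  shows "\<exists>col :: 'a \<Rightarrow> nat. conflict_free (G :: 'a graph) col \<and>
           card (col ` verts G) = cf_chromatic_number G"
proof -
  have "finite (verts G)"
    using assms by (simp add: finite_simple_graph_def)
  then obtain col :: "'a \<Rightarrow> nat" where "inj_on col (verts G)"
    using finite_imp_inj_to_nat_seg by blast
  then have "\<exists>k. \<exists>col :: 'a \<Rightarrow> nat. conflict_free G col \<and> card (col ` verts G) = k"
    using conflict_free_if_inj_on[OF assms] by blast
  then show ?thesis
    unfolding cf_chromatic_number_def by (rule LeastI_ex)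
qed

end

theory Submission
  imports Defs
begin

text \<open>
  Let a conflict-free colouring of the edges of the complete graph use \<open>k\<close> colours, and let the
  palette of a vertex be the set of colours on its incident edges. If \<open>u\<close> and \<open>v\<close> have the same
  palette, the colour that is unique around the edge \<open>uv\<close> occurs both at \<open>u\<close> and at \<open>v\<close>, so the
  one edge carrying it is \<open>uv\<close> itself. Hence the edges from \<open>u\<close> to the other vertices with its
  palette have distinct colours, and each palette is shared by at most \<open>k + 1\<close> vertices. As there
  are at most \<open>2 ^ k\<close> palettes, \<open>n \<le> 2 ^ k * (k + 1) \<le> 4 ^ k\<close>.
\<close>

definition palette :: "'a set \<Rightarrow> ('a set \<Rightarrow> 'c) \<Rightarrow> 'a \<Rightarrow> 'c set" where
  "palette V col v = (\<lambda>w. col {v, w}) ` (V - {v})"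

text \<open>A nonempty \<open>e\<close> meets itself, so the vertex \<open>e\<close> of its own
  closed neighborhood satisfies the same intersection condition as its neighbors and needs no
  separate case.\<close>

lemma closed_nbhd_line_graph:
  assumes "e \<in> edges H" "e \<noteq> {}"
  shows "closed_nbhd (line_graph H) e = {f \<in> edges H. f \<inter> e \<noteq> {}}"
  using assms by (auto simp: closed_nbhd_def line_graph_def doubleton_eq_iff)

lemma doubleton_in_edges_complete_graph:
  "{u, v} \<in> edges (complete_graph n) \<longleftrightarrow> u \<in> {1..n} \<and> v \<in> {1..n} \<and> u \<noteq> v"
  by (auto simp: complete_graph_def card_2_iff')

lemma edge_of_complete_graphE:
  assumes "f \<in> edges (complete_graph n)" "x \<in> f"
  obtains y where "f = {x, y}" "x \<in> {1..n}" "y \<in> {1..n} - {x}"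
proof -
  have f: "card f = 2" "f \<subseteq> {1..n}"
    using assms by (auto simp: complete_graph_def)
  obtain a b where "f = {a, b}" "a \<noteq> b"
    using f by (auto simp: card_2_iff)
  with f assms that show thesis
    by (cases "x = a") auto
qed

lemma same_palette_edge_unique:
  assumes cf: "conflict_free (line_graph (complete_graph n)) col"
    and u: "u \<in> {1..n}" and v: "v \<in> {1..n}" and "u \<noteq> v"
    and same: "palette {1..n} col u = palette {1..n} col v"
    and w: "w \<in> {1..n} - {u}" and col: "col {u, w} = col {u, v}"
  shows "w = v"
proof -
  let ?G = "line_graph (complete_graph n)"
  have uv: "{u, v} \<in> edges (complete_graph n)"
    using u v \<open>u \<noteq> v\<close> by (simp add: doubleton_in_edges_complete_graph)
  then have nbhd: "closed_nbhd ?G {u, v} = {f \<in> edges (complete_graph n). f \<inter> {u, v} \<noteq> {}}"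
    by (intro closed_nbhd_line_graph) auto
  have "{u, v} \<in> verts ?G"
    using uv by (simp add: line_graph_def)
  then obtain c f where f: "f \<in> closed_nbhd ?G {u, v}" "col f = c"
    and uniq: "\<And>g. g \<in> closed_nbhd ?G {u, v} \<Longrightarrow> col g = c \<Longrightarrow> g = f"
    using cf unfolding conflict_free_def by metis
  obtain x where x: "x \<in> f" "x \<in> {u, v}"
    using f nbhd by blast
  have "f \<in> edges (complete_graph n)"
    using f nbhd by blast
  then obtain y where "f = {x, y}" "y \<in> {1..n} - {x}"
    using x by (elim edge_of_complete_graphE)
  then have "c \<in> palette {1..n} col x"
    using f by (auto simp: palette_def)
  \<comment> \<open>Since \<open>x\<close> is \<open>u\<close> or \<open>v\<close>, equality of the
    palettes carries \<open>c\<close> over to the other end.\<close>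
  then have "c \<in> palette {1..n} col u" "c \<in> palette {1..n} col v"
    using x same by auto
  then obtain a b where a: "a \<in> {1..n} - {u}" "col {u, a} = c"
    and b: "b \<in> {1..n} - {v}" "col {v, b} = c"
    unfolding palette_def by (elim imageE) metis
  \<comment> \<open>Both \<open>{u, a}\<close> and \<open>{v, b}\<close> meet \<open>{u, v}\<close>
    and have color \<open>c\<close>, so uniqueness identifies each with \<open>f\<close>, which
    therefore contains \<open>u\<close> and \<open>v\<close>.\<close>
  have "{u, a} = f"
    using a u by (intro uniq) (auto simp: nbhd doubleton_in_edges_complete_graph)
  moreover have "{v, b} = f"
    using b v by (intro uniq) (auto simp: nbhd doubleton_in_edges_complete_graph)
  ultimately have fuv: "f = {u, v}"
    using \<open>u \<noteq> v\<close> by (auto simp: doubleton_eq_iff)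
  \<comment> \<open>Now \<open>c\<close> is the color of \<open>{u, v}\<close> itself, so by
    assumption \<open>{u, w}\<close> has color \<open>c\<close> too and uniqueness applies once
    more.\<close>
  have "{u, w} = f"
    using w u col f fuv by (intro uniq) (auto simp: nbhd doubleton_in_edges_complete_graph)
  with fuv w show ?thesis
    by (auto simp: doubleton_eq_iff)
qed

lemma card_same_palette_le:
  assumes cf: "conflict_free (line_graph (complete_graph n)) col"
    and u: "u \<in> {1..n}"
  shows "card {v \<in> {1..n}. palette {1..n} col v = palette {1..n} col u}
           \<le> card (col ` edges (complete_graph n)) + 1"
proof -
  let ?A = "{v \<in> {1..n}. palette {1..n} col v = palette {1..n} col u}"
  \<comment> \<open>If two members of the class give the same color, one serves as \<open>v\<close>
    and the other as \<open>w\<close> in the preceding lemma.\<close>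
  have "inj_on (\<lambda>v. col {u, v}) (?A - {u})"
    using same_palette_edge_unique[OF cf u] by (intro inj_onI) auto
  moreover have "(\<lambda>v. col {u, v}) ` (?A - {u}) \<subseteq> col ` edges (complete_graph n)"
    using u by (auto simp: doubleton_in_edges_complete_graph)
  moreover have "finite (col ` edges (complete_graph n))"
    by (simp add: complete_graph_def)
  ultimately have "card (?A - {u}) \<le> card (col ` edges (complete_graph n))"
    by (rule card_inj_on_le)
  \<comment> \<open>The extra 1 accounts for \<open>u\<close>, which lies in its own class but is
    not joined to itself.\<close>
  then show ?thesis
    using u by (simp add: card_Diff_singleton_if split: if_splits)
qed

lemma conflict_free_line_complete_graph_le:
  assumes "conflict_free (line_graph (complete_graph n)) col"
    and "card (col ` verts (line_graph (complete_graph n))) = k"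
  shows "n \<le> 2 ^ k * (k + 1)"
proof -
  let ?C = "col ` edges (complete_graph n)"
  let ?P = "palette {1..n} col"
  have finC: "finite ?C" and k: "card ?C = k"
    using assms(2) by (simp_all add: complete_graph_def line_graph_def)
  have "?P ` {1..n} \<subseteq> Pow ?C"
    by (auto simp: palette_def doubleton_in_edges_complete_graph)
  then have "card (?P ` {1..n}) \<le> card (Pow ?C)"
    using finC by (intro card_mono) auto
  then have palettes: "card (?P ` {1..n}) \<le> 2 ^ k"
    by (simp only: card_Pow[OF finC] k)
  \<comment> \<open>The vertices are counted through the fibers of the palette map.\<close>
  have "n = card (\<Union>S \<in> ?P ` {1..n}. {v \<in> {1..n}. ?P v = S})"
  proof -
    have "(\<Union>S \<in> ?P ` {1..n}. {v \<in> {1..n}. ?P v = S}) = {1..n}"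
      by auto
    then show ?thesis
      by simp
  qed
  also have "\<dots> \<le> (\<Sum>S \<in> ?P ` {1..n}. card {v \<in> {1..n}. ?P v = S})"
    by (intro card_UN_le) simp
  also have "\<dots> \<le> card (?P ` {1..n}) * (k + 1)"
  proof -
    have "card {v \<in> {1..n}. ?P v = S} \<le> k + 1" if S: "S \<in> ?P ` {1..n}" for S
    proof -
      obtain u where "u \<in> {1..n}" "S = ?P u"
        using S by blast
      then show ?thesis
        using card_same_palette_le[OF assms(1), of u] k by simp
    qed
    then show ?thesis
      by (intro order_trans[OF sum_bounded_above[where K = "k + 1"]]) auto
  qed
  also have "\<dots> \<le> 2 ^ k * (k + 1)"
    using palettes by (rule mult_le_mono1)
  finally show ?thesis .
qed

theorem theorem3:
  "\<exists>c::real. c > 0 \<and>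
     (\<forall>n::nat. n > 1 \<longrightarrow>
        real (cf_chromatic_number (line_graph (complete_graph n))) \<ge> c * ln (real n))"
\<comment> \<open>The constant comes from taking logarithms in n \<le> 4^k, which gives ln n \<le> k
  ln 4.\<close>
proof (intro exI[of _ "1 / ln 4"] conjI allI impI)
  fix n :: nat assume "n > 1"
  define k where "k = cf_chromatic_number (line_graph (complete_graph n))"
  obtain col :: "nat set \<Rightarrow> nat" where "conflict_free (line_graph (complete_graph n)) col"
    and "card (col ` verts (line_graph (complete_graph n))) = k"
    using cf_chromatic_number_attained[OF finite_simple_graph_line_graph
        [OF finite_simple_graph_complete_graph]] unfolding k_def by blast
  then have "n \<le> 2 ^ k * (k + 1)"
    by (rule conflict_free_line_complete_graph_le)
  \<comment> \<open>The strict inequality k < 2^k between integers absorbs the factor k + 1.\<close>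
  also have "\<dots> \<le> 2 ^ k * 2 ^ k"
    by (intro mult_le_mono2) (use less_exp[of k] in \<open>simp only: Suc_eq_plus1[symmetric] Suc_le_eq\<close>)
  also have "\<dots> = 4 ^ k"
    by (simp flip: power_mult_distrib)
  finally have "real n \<le> real (4 ^ k)"
    by (simp only: of_nat_le_iff)
  then have "ln (real n) \<le> ln (real (4 ^ k))"
    using \<open>n > 1\<close> by (intro ln_mono) auto
  then show "1 / ln 4 * ln (real n) \<le> real (cf_chromatic_number (line_graph (complete_graph n)))"
    by (simp add: ln_realpow k_def field_simps)
qed simp

end
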